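(* Let $a\in\mathbb{R}$, $q,r\in\mathbb{R}$ with $q\ne0$, and $\mathfrak{S}=\{x\in\mathbb{C}: -1\le \operatorname{Im}(x)\le 0\}$. Let $F$ be a complex function analytic on an open set containing $\{a\,x(x+i): x\in\mathfrak{S}\}$ such that, uniformly for $x\in\mathfrak{S}$ as $\operatorname{Re}(x)\to\pm\infty$, $F(a\,x(x+i))=o\!\left(e^{\pi|x|}/|x|\right)$ and $\dfrac{F(a\,x(x+i))}{\sinh(\pi(q+ir)(2x+i))}\to0$. Assume that the integrand below has no pole on the real axis (automatic if $(q^2+r^2)/q$ is not an integer). Then $$\int_{-\infty}^{\infty}\frac{F(a\,x(x+i))}{\sinh(\pi(q+ir)(i+2x))}\,dx=-\frac{i}{2}\,\frac{F(a/4)}{q+ir}-\frac{i}{q+ir}\sum_{n=1}^{M}(-1)^n\,F\!\left(\frac{a\,\big((q+ir)^2-n^2\big)}{4(q+ir)^2}\right),$$ where $M=\left\lfloor \dfrac{q^2+r^2}{|q|}\right\rfloor$.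
   Context: The integral over the real line is understood as $\lim_{R\to\infty}\int_{-R}^{R}$ (removable singularities of the integrand being filled in). $\lfloor y\rfloor$ is the greatest integer not exceeding $y$; an empty sum is $0$. *)

theory Defs
  imports "HOL-Complex_Analysis.Complex_Analysis" "HOL-Library.Landau_Symbols"
begin

definition strip :: "complex set" where
  "strip = {x. -1 \<le> Im x \<and> Im x \<le> 0}"

(* The limit \<open>Re x \<rightarrow> \<plusminus>\<infinity>\<close>, uniformly for \<open>x\<close> in the strip: a property holds eventually
   iff it holds at all points of the strip with \<open>\<bar>Re x\<bar>\<close> sufficiently large. *)
definition strip_ends :: "complex filter" where
  "strip_ends = inf (filtercomap (\<lambda>x. \<bar>Re x\<bar>) at_top) (principal strip)"

definition integrand :: "(complex \<Rightarrow> complex) \<Rightarrow> real \<Rightarrow> complex \<Rightarrow> complex \<Rightarrow> complex" where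
  "integrand F a c x =
     F (of_real a * x * (x + \<i>)) / sinh (of_real pi * c * (\<i> + 2 * x))"

(* The limit of the integrals over \<open>{-R..R}\<close>. Integrability is required separately because
   \<open>integral\<close> is 0 for a non-integrable function. *)
definition has_symmetric_integral :: "(real \<Rightarrow> complex) \<Rightarrow> complex \<Rightarrow> bool" where
  "has_symmetric_integral f I \<longleftrightarrow>
     (\<forall>R. f integrable_on {-R..R}) \<and>
     ((\<lambda>R. integral {-R..R} f) \<longlongrightarrow> I) at_top"

end

theory Submission
  imports Defs
begin

text \<open>
  The argument \<open>a x (x + \<i>)\<close> is invariant under the point reflection \<open>x \<mapsto> - \<i> - x\<close> about
  \<open>- \<i>/2\<close>, while \<open>sinh (\<pi> c (2 x + \<i>))\<close> changes sign. So the integrand \<open>h\<close> is odd under this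
  reflection, which interchanges the two edges of the strip. Integrating \<open>h\<close> around the
  rectangle with vertices \<open>\<plusminus>R\<close> and \<open>\<plusminus>R - \<i>\<close>, the two horizontal sides give the same
  contribution \<open>- \<integral> h\<close>, and the vertical ones vanish in the limit because \<open>h \<longlongrightarrow> 0\<close>. Hence the integral
  is \<open>- \<pi> \<i>\<close> times the sum of the residues inside the strip; this is \<open>odd_strip_integral\<close>.

  The denominator vanishes exactly at \<open>p n = - \<i>/2 + \<i> n/(2 c)\<close> for integers \<open>n\<close>. All these
  zeros are simple, and \<open>p n\<close> lies in the closed strip iff \<open>\<bar>n\<bar> \<le> M\<close>. By
  \<open>simple_zero_quotient\<close> the residue there is \<open>(-1)^n F(a p(n) (p(n) + \<i>)) / (2 \<pi> c)\<close>, and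
  \<open>p(n) (p(n) + \<i>) = (c^2 - n^2) / (4 c^2)\<close> is even in \<open>n\<close>, so that the terms for \<open>n\<close> and \<open>- n\<close>
  combine into one (\<open>sum_symmetric_int\<close>).

  The delicate case is that \<open>(q^2 + r^2)/q\<close> is an integer: then \<open>p M\<close> and \<open>p (- M)\<close> lie on the two
  edges, one on each. If there is no pole on the real axis, the numerator vanishes at the one on the real
  axis, and hence, by symmetry, at the other. Both singularities are then removable, and the term \<open>n = M\<close>
  in the formula is zero, so the residue theorem applied to \<open>remove_sings h\<close> gives the same formula.
\<close>

section \<open>Quotients with a simple zero in the denominator\<close>

text \<open>
  The last three claims come from \<open>D w / (w - z) \<midarrow>z\<rightarrow> d\<close>. The residue formula also covers a
  numerator that vanishes at \<open>z\<close>, which is why it is derived from the limit of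
  \<open>G w / D w * (w - z)\<close> rather than from the pole order.
\<close>

lemma simple_zero_quotient:
  fixes G D :: "complex \<Rightarrow> complex"
  assumes G: "G analytic_on {z}" and D: "D analytic_on {z}" "D z = 0"
    and d: "(D has_field_derivative d) (at z)" "d \<noteq> 0"
  shows isolated_singularity_at_simple_zero_quotient: "isolated_singularity_at (\<lambda>w. G w / D w) z"
    and residue_simple_zero_quotient: "residue (\<lambda>w. G w / D w) z = G z / d"
    and is_pole_simple_zero_quotient: "G z \<noteq> 0 \<Longrightarrow> is_pole (\<lambda>w. G w / D w) z"
    and tendsto_simple_zero_quotient:
      "G z = 0 \<Longrightarrow> (\<lambda>w. G w / D w) \<midarrow>z\<rightarrow> deriv G z / d"
proof -
  have slope_D: "((\<lambda>w. D w / (w - z)) \<longlongrightarrow> d) (at z)"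
    using d(1) D(2) by (simp add: has_field_derivative_iff)
  have nz: "eventually (\<lambda>w. D w / (w - z) \<noteq> 0) (at z)"
    by (rule tendsto_imp_eventually_ne[OF slope_D d(2)])
  have contG: "G \<midarrow>z\<rightarrow> G z"
    using analytic_at_imp_isCont[OF G] by (simp add: isCont_def)
  have contD: "D \<midarrow>z\<rightarrow> 0"
    using analytic_at_imp_isCont[OF D(1)] D(2) by (simp add: isCont_def)
  show iso: "isolated_singularity_at (\<lambda>w. G w / D w) z"
    using G D(1) by (intro isolated_singularity_at_divide isolated_singularity_at_analytic
        not_essential_analytic)
  obtain e where e: "e > 0" "(\<lambda>w. G w / D w) analytic_on ball z e - {z}"
    using iso by (auto simp: isolated_singularity_at_def)
  have "(\<lambda>w. G w / (D w / (w - z))) \<midarrow>z\<rightarrow> G z / d"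
    by (intro tendsto_divide contG slope_D d(2))
  then have "(\<lambda>w. G w / D w * (w - z)) \<midarrow>z\<rightarrow> G z / d"
    by simp
  then show "residue (\<lambda>w. G w / D w) z = G z / d"
    using e by (intro residue_simple'[of "ball z e"]) (auto intro: analytic_imp_holomorphic)
  show "is_pole (\<lambda>w. G w / D w) z" if "G z \<noteq> 0"
  proof (rule is_pole_divide)
    show "isCont G z"
      by (rule analytic_at_imp_isCont[OF G])
    show "filterlim D (at 0) (at z)"
      using contD nz by (auto simp: filterlim_at elim: eventually_mono)
  qed fact
  show "(\<lambda>w. G w / D w) \<midarrow>z\<rightarrow> deriv G z / d" if "G z = 0"
  proof -
    have "(G has_field_derivative deriv G z) (at z)"
      using G analytic_on_imp_differentiable_at DERIV_deriv_iff_field_differentiable by blast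
    then have "(\<lambda>w. G w / (w - z)) \<midarrow>z\<rightarrow> deriv G z"
      using that by (simp add: has_field_derivative_iff)
    then have "(\<lambda>w. G w / (w - z) / (D w / (w - z))) \<midarrow>z\<rightarrow> deriv G z / d"
      by (intro tendsto_divide slope_D d(2))
    then show ?thesis
      by (rule Lim_transform_eventually) (auto simp: eventually_at_filter)
  qed
qed

section \<open>Odd functions on the strip\<close>

lemma remove_sings_minus: "remove_sings (\<lambda>w. - h w) z = - remove_sings h z"
proof (cases "\<exists>c. h \<midarrow>z\<rightarrow> c")
  case True
  then obtain c where "h \<midarrow>z\<rightarrow> c" by blast
  then show ?thesis
    using tendsto_minus[of h c "at z"] by (simp add: remove_sings_eqI)
next
  case False
  then have "\<nexists>c. (\<lambda>w. - h w) \<midarrow>z\<rightarrow> c"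
    by (metis tendsto_minus_cancel_left)
  with False show ?thesis
    by (simp add: remove_sings_def)
qed

lemma eventually_strip_ends:
  "eventually P strip_ends \<longleftrightarrow> (\<exists>B. \<forall>z\<in>strip. B \<le> \<bar>Re z\<bar> \<longrightarrow> P z)"
  by (auto simp: strip_ends_def eventually_inf_principal eventually_filtercomap
        eventually_at_top_linorder)

lemma contour_integral_rectpath_eq:
  assumes cont: "continuous_on (path_image (rectpath a1 a3)) f"
    and le: "Re a1 \<le> Re a3" "Im a1 \<le> Im a3"
  defines "a2 \<equiv> Complex (Re a3) (Im a1)" and "a4 \<equiv> Complex (Re a1) (Im a3)"
  shows "contour_integral (rectpath a1 a3) f =
           contour_integral (linepath a1 a2) f + contour_integral (linepath a2 a3) f +
           contour_integral (linepath a3 a4) f + contour_integral (linepath a4 a1) f"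
    and "f contour_integrable_on linepath a2 a3" "f contour_integrable_on linepath a4 a1"
proof -
  have img: "path_image (rectpath a1 a3) =
      closed_segment a1 a2 \<union> closed_segment a2 a3 \<union> closed_segment a3 a4 \<union> closed_segment a4 a1"
    by (simp add: rectpath_def Let_def path_image_join a2_def a4_def Un_assoc)
  have int: "f contour_integrable_on linepath u v"
    if "closed_segment u v \<subseteq> path_image (rectpath a1 a3)" for u v
    using cont that by (intro contour_integrable_continuous_linepath) (rule continuous_on_subset)
  have i: "f contour_integrable_on linepath a1 a2" "f contour_integrable_on linepath a2 a3"
    "f contour_integrable_on linepath a3 a4" "f contour_integrable_on linepath a4 a1"
    by (rule int; use img in blast)+
  show "f contour_integrable_on linepath a2 a3" "f contour_integrable_on linepath a4 a1"
    by fact+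
  show "contour_integral (rectpath a1 a3) f =
           contour_integral (linepath a1 a2) f + contour_integral (linepath a2 a3) f +
           contour_integral (linepath a3 a4) f + contour_integral (linepath a4 a1) f"
    using i by (simp add: rectpath_def Let_def flip: a2_def a4_def)
qed

text \<open>
  The residue theorem needs a connected open domain outside which the path has winding number 0. A small
  neighbourhood of the closed rectangle inside \<open>V\<close> will do: it is convex as the sum of the rectangle and
  a ball. So nothing has to be assumed about the shape of \<open>V\<close>.
\<close>

lemma Residue_theorem_rectpath:
  assumes V: "open V" "cbox a b \<subseteq> V" and P: "finite P" "P \<subseteq> box a b"
    and f: "f holomorphic_on V - P" and le: "Re a \<le> Re b" "Im a \<le> Im b"
  shows "contour_integral (rectpath a b) f = 2 * pi * \<i> * (\<Sum>p\<in>P. residue f p)"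
proof -
  obtain e where e: "e > 0" "(\<Union>x\<in>cbox a b. ball x e) \<subseteq> V"
    using compact_subset_open_imp_ball_epsilon_subset[OF compact_cbox V] by blast
  define S where "S = (\<Union>x\<in>cbox a b. \<Union>y\<in>ball 0 e. {x + y})"
  have S_ball: "x + y \<in> ball x e" if "y \<in> ball 0 e" for x y :: complex
    using that by (simp add: dist_norm)
  have "S \<subseteq> V"
    using e(2) S_ball unfolding S_def by blast
  have box_S: "cbox a b \<subseteq> S"
    using e(1) unfolding S_def by force
  have "open S"
    using open_sums[of "cbox a b" "ball 0 e"] unfolding S_def
    by (auto simp: UNION_singleton_eq_range image_def)
  have "convex S"
    unfolding S_def by (intro convex_sums) auto
  have "contour_integral (rectpath a b) f
      = 2 * pi * \<i> * (\<Sum>p\<in>P. winding_number (rectpath a b) p * residue f p)"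
  proof (rule Residue_theorem)
    show "connected S"
      using \<open>convex S\<close> by (rule convex_connected)
    show "f holomorphic_on S - P"
      by (rule holomorphic_on_subset[OF f]) (use \<open>S \<subseteq> V\<close> in auto)
    show "path_image (rectpath a b) \<subseteq> S - P"
      using path_image_rectpath_cbox_minus_box[OF le] P box_S by auto
    show "\<forall>z. z \<notin> S \<longrightarrow> winding_number (rectpath a b) z = 0"
      using box_S le by (auto intro!: winding_number_rectpath_outside)
  qed (use P \<open>open S\<close> in auto)
  also have "(\<Sum>p\<in>P. winding_number (rectpath a b) p * residue f p) = (\<Sum>p\<in>P. residue f p)"
    using P by (intro sum.cong) (auto simp: winding_number_rectpath subset_iff)
  finally show ?thesis .
qed

text \<open>
  The reflection \<open>z \<mapsto> - \<i> - z\<close> maps the bottom side of the rectangle, run from left to right, to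
  the top side, run from right to left. As \<open>f\<close> and \<open>dz\<close> both change sign, the two sides contribute the
  same amount to the contour integral.
\<close>

lemma odd_strip_integral:
  assumes V: "open V" "strip \<subseteq> V" and P: "finite P" "P \<subseteq> {z. -1 < Im z \<and> Im z < 0}"
    and f: "f holomorphic_on V - P" and odd: "\<And>z. f (- \<i> - z) = - f z"
    and lim: "(f \<longlongrightarrow> 0) strip_ends"
  shows "has_symmetric_integral (\<lambda>x. f (of_real x)) (- (pi * \<i>) * (\<Sum>p\<in>P. residue f p))"
proof -
  define I where "I R = integral {-R..R} (\<lambda>x. f (of_real x))" for R
  define side where "side R = contour_integral (linepath (Complex R (-1)) (Complex R 0)) f
      + contour_integral (linepath (Complex (-R) 0) (Complex (-R) (-1))) f" for R
  have cont: "continuous_on (V - P) f"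
    using f by (rule holomorphic_on_imp_continuous_on)
  have "bounded (Re ` P)"
    using P by (intro finite_imp_bounded) auto
  then obtain B where B: "\<And>p. p \<in> P \<Longrightarrow> \<bar>Re p\<bar> \<le> B"
    unfolding bounded_iff by auto
  have rect: "continuous_on (path_image (rectpath (Complex (-R) (-1)) (Complex R 0))) f"
    and eq: "I R = - (pi * \<i>) * (\<Sum>p\<in>P. residue f p) + side R / 2"
    if R: "R > B" "R > 0" for R
  proof -
    let ?a = "Complex (-R) (-1)" and ?b = "Complex R 0"
    have box_V: "cbox ?a ?b \<subseteq> V"
      using V(2) by (auto simp: in_cbox_complex_iff strip_def)
    have P_box: "P \<subseteq> box ?a ?b"
      using P(2) B R by (force simp: in_box_complex_iff)
    have "path_image (rectpath ?a ?b) \<subseteq> V - P"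
      using path_image_rectpath_cbox_minus_box[of ?a ?b] R box_V P_box by auto
    with cont show rect: "continuous_on (path_image (rectpath ?a ?b)) f"
      by (rule continuous_on_subset)
    have top: "contour_integral (linepath ?b (Complex (-R) 0)) f = - I R"
    proof -
      have "continuous_on (closed_segment (Complex (-R) 0) ?b) f"
        by (rule continuous_on_subset[OF rect])
           (use R in \<open>auto simp: path_image_rectpath closed_segment_same_Im closed_segment_eq_real_ivl\<close>)
      then have "contour_integral (linepath (Complex (-R) 0) ?b) f
          = - contour_integral (linepath ?b (Complex (-R) 0)) f"
        by (rule contour_integral_reverse_linepath)
      moreover have "contour_integral (linepath (Complex (-R) 0) ?b) f = I R"
        unfolding I_def using R
        by (subst contour_integral_linepath_Reals_eq) (auto simp: complex_is_Real_iff)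
      ultimately show ?thesis by simp
    qed
    have bottom: "contour_integral (linepath ?a (Complex R (-1))) f
        = contour_integral (linepath ?b (Complex (-R) 0)) f"
    proof -
      have "linepath ?a (Complex R (-1)) t = - \<i> - linepath ?b (Complex (-R) 0) t" for t
        by (simp add: complex_eq_iff linepath_def algebra_simps)
      then have "f (linepath ?a (Complex R (-1)) t) = - f (linepath ?b (Complex (-R) 0) t)" for t
        by (simp add: odd)
      moreover have "Complex R (-1) - ?a = - (Complex (-R) 0 - ?b)"
        by (simp add: complex_eq_iff)
      ultimately show ?thesis
        unfolding contour_integral_integral vector_derivative_linepath_at
        by (simp only: mult_minus_left mult_minus_right minus_minus)
    qed
    have "2 * pi * \<i> * (\<Sum>p\<in>P. residue f p) = contour_integral (rectpath ?a ?b) f"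
      by (rule Residue_theorem_rectpath[symmetric, OF V(1) box_V P(1) P_box f]) (use R in auto)
    also have "\<dots> = - 2 * I R + side R"
      using contour_integral_rectpath_eq(1)[OF rect] R top bottom by (simp add: side_def)
    finally show "I R = - (pi * \<i>) * (\<Sum>p\<in>P. residue f p) + side R / 2"
      by (simp add: field_simps)
  qed
  have "(side \<longlongrightarrow> 0) at_top"
  proof (rule tendstoI)
    fix e :: real assume "e > 0"
    then have "eventually (\<lambda>z. dist (f z) 0 < e / 4) strip_ends"
      using lim by (intro tendstoD) auto
    then obtain C where C: "\<And>z. z \<in> strip \<Longrightarrow> C \<le> \<bar>Re z\<bar> \<Longrightarrow> norm (f z) < e / 4"
      by (auto simp: eventually_strip_ends)
    have "dist (side R) 0 < e" if R: "R > max (max B C) 0" for R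
    proof -
      have R': "R > B" "R > 0" "R > C" using R by auto
      note int = contour_integral_rectpath_eq(2,3)[OF rect[OF R'(1,2)]]
      have "norm (contour_integral (linepath (Complex R (-1)) (Complex R 0)) f)
          \<le> e / 4 * norm (Complex R 0 - Complex R (-1))"
      proof (rule contour_integral_bound_linepath)
        show "norm (f z) \<le> e / 4" if "z \<in> closed_segment (Complex R (-1)) (Complex R 0)" for z
          using that R' C[of z]
          by (auto simp: closed_segment_same_Re closed_segment_eq_real_ivl strip_def)
      qed (use int R' \<open>e > 0\<close> in auto)
      moreover have "norm (contour_integral (linepath (Complex (-R) 0) (Complex (-R) (-1))) f)
          \<le> e / 4 * norm (Complex (-R) (-1) - Complex (-R) 0)"
      proof (rule contour_integral_bound_linepath)
        show "norm (f z) \<le> e / 4" if "z \<in> closed_segment (Complex (-R) 0) (Complex (-R) (-1))" for z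
          using that R' C[of z]
          by (auto simp: closed_segment_same_Re closed_segment_eq_real_ivl strip_def)
      qed (use int R' \<open>e > 0\<close> in auto)
      moreover have "norm (Complex R 0 - Complex R (-1)) = 1"
        "norm (Complex (-R) (-1) - Complex (-R) 0) = 1"
        by (simp_all add: cmod_def)
      ultimately have "norm (side R) \<le> e / 4 + e / 4"
        unfolding side_def by (intro order.trans[OF norm_triangle_ineq] add_mono) auto
      with \<open>e > 0\<close> show ?thesis by simp
    qed
    then show "eventually (\<lambda>R. dist (side R) 0 < e) at_top"
      unfolding eventually_at_top_dense by blast
  qed
  then have "((\<lambda>R. - (pi * \<i>) * (\<Sum>p\<in>P. residue f p) + side R / 2)
      \<longlongrightarrow> - (pi * \<i>) * (\<Sum>p\<in>P. residue f p) + 0 / 2) at_top"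
    by (intro tendsto_intros) auto
  moreover have "eventually (\<lambda>R. - (pi * \<i>) * (\<Sum>p\<in>P. residue f p) + side R / 2 = I R) at_top"
    using eventually_gt_at_top[of "max B 0"] by eventually_elim (simp add: eq)
  ultimately have "(I \<longlongrightarrow> - (pi * \<i>) * (\<Sum>p\<in>P. residue f p) + 0 / 2) at_top"
    by (rule Lim_transform_eventually)
  moreover have "(\<lambda>x. f (of_real x)) integrable_on {-R..R}" for R
  proof (rule integrable_continuous_real)
    have "of_real ` {-R..R} \<subseteq> V - P"
      using V(2) P(2) by (auto simp: strip_def)
    then show "continuous_on {-R..R} (\<lambda>x. f (of_real x))"
      by (intro continuous_on_compose2[OF cont]) (auto intro!: continuous_intros)
  qed
  ultimately show ?thesis
    by (simp add: has_symmetric_integral_def I_def[abs_def])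
qed

section \<open>The zeros of the denominator\<close>

lemma sinh_eq_0_iff_complex:
  "sinh z = 0 \<longleftrightarrow> (\<exists>n::int. z = \<i> * of_real pi * of_int n)" for z :: complex
proof
  assume "sinh z = 0"
  then obtain n :: int where "\<i> * z = of_real (n * pi)"
    by (auto simp: sinh_conv_sin sin_eq_0)
  then have "\<i> * (\<i> * z) = \<i> * of_real (n * pi)" by simp
  then have "- z = \<i> * (of_int n * of_real pi)"
    by (simp flip: mult.assoc)
  then have "z = \<i> * of_real pi * of_int (- n)"
    by (metis (no_types) minus_minus mult.assoc mult.commute mult_minus_right of_int_minus)
  then show "\<exists>n::int. z = \<i> * of_real pi * of_int n" by blast
next
  assume "\<exists>n::int. z = \<i> * of_real pi * of_int n"
  then obtain n :: int where n: "z = \<i> * of_real pi * of_int n" by blast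
  have "\<i> * z = of_real (of_int (- n) * pi)"
    using n by (simp add: algebra_simps)
  then show "sinh z = 0"
    unfolding sinh_conv_sin mult_eq_0_iff sin_eq_0 by blast
qed

lemma cosh_i_pi_int: "cosh (\<i> * of_real pi * of_int n) = (-1) ^ nat \<bar>n\<bar>"
proof -
  have "cosh (\<i> * of_real pi * of_int n) = cos (of_real (pi * of_int n))"
    by (simp add: cosh_conv_cos flip: mult.assoc)
  also have "\<dots> = of_real (cos (pi * of_int n))"
    by (rule cos_of_real)
  also have "\<dots> = (-1) ^ nat \<bar>n\<bar>"
    by (simp add: even_nat_iff)
  finally show ?thesis .
qed

lemma sum_symmetric_int:
  fixes t :: "int \<Rightarrow> complex"
  assumes "\<And>n. t (- n) = t n"
  shows "(\<Sum>n\<in>{-int M..int M}. t n) = t 0 + 2 * (\<Sum>n=1..M. t (int n))"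
proof (induction M)
  case (Suc M)
  have "{-int (Suc M)..int (Suc M)} = insert (int (Suc M)) (insert (- int (Suc M)) {-int M..int M})"
    by auto
  then show ?case
    using Suc assms[of "int (Suc M)"] by (simp add: algebra_simps del: of_nat_Suc)
qed simp

section \<open>The integral\<close>

theorem mainTheorem5:
  fixes a q r :: real and F :: "complex \<Rightarrow> complex" and U :: "complex set"
    and c :: complex and M :: nat
  defines "c \<equiv> of_real q + \<i> * of_real r"
    and "M \<equiv> nat \<lfloor>(q\<^sup>2 + r\<^sup>2) / \<bar>q\<bar>\<rfloor>"
  assumes "q \<noteq> 0"
    and "open U"
    and "(\<lambda>x. of_real a * x * (x + \<i>)) ` strip \<subseteq> U"
    and "F analytic_on U"
    and "(\<lambda>x. F (of_real a * x * (x + \<i>)))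
           \<in> o[strip_ends](\<lambda>x. of_real (exp (pi * norm x) / norm x))"
    and "((\<lambda>x. F (of_real a * x * (x + \<i>)) / sinh (of_real pi * c * (2 * x + \<i>))) \<longlongrightarrow> 0)
           strip_ends"
  shows "((q\<^sup>2 + r\<^sup>2) / q \<notin> \<int> \<longrightarrow> (\<forall>x::real. \<not> is_pole (integrand F a c) (of_real x))) \<and>
         ((\<forall>x::real. \<not> is_pole (integrand F a c) (of_real x)) \<longrightarrow>
           has_symmetric_integral (\<lambda>x. remove_sings (integrand F a c) (of_real x))
             (- (\<i> / 2) * (F (of_real a / 4) / c)
              - \<i> / c * (\<Sum>n = 1..M. (-1) ^ n *
                   F (of_real a * (c\<^sup>2 - (of_nat n)\<^sup>2) / (4 * c\<^sup>2)))))"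
proof -
  define N where "N = q\<^sup>2 + r\<^sup>2"
  have "N > 0"
    using \<open>q \<noteq> 0\<close> by (simp add: N_def add_pos_nonneg)
  have c: "Re c = q" "Im c = r" "c \<noteq> 0"
    using \<open>q \<noteq> 0\<close> by (auto simp: c_def complex_eq_iff)
  define g where "g x = F (of_real a * x * (x + \<i>))" for x
  define D where "D x = sinh (of_real pi * c * (\<i> + 2 * x))" for x
  define h where "h = integrand F a c"
  define p where "p n = - \<i> / 2 + \<i> * of_int n / (2 * c)" for n :: int
  have h_eq: "h = (\<lambda>x. g x / D x)"
    by (simp add: h_def integrand_def g_def D_def fun_eq_iff)
  have g_sym: "g (- \<i> - x) = g x" for x
    unfolding g_def by (rule arg_cong[of _ _ F]) (simp add: algebra_simps)
  have D_odd: "D (- \<i> - x) = - D x" for x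
  proof -
    have "of_real pi * c * (\<i> + 2 * (- \<i> - x)) = - (of_real pi * c * (\<i> + 2 * x))"
      by (simp add: algebra_simps)
    then show ?thesis by (simp only: D_def sinh_minus)
  qed
  have Im_p: "Im (p n) = - 1/2 + n * q / (2 * N)" for n
  proof -
    have "Im (p n) = - 1/2 + n * q * 2 / ((2 * q)\<^sup>2 + (2 * r)\<^sup>2)"
      by (simp add: p_def Im_divide c)
    also have "(2 * q)\<^sup>2 + (2 * r)\<^sup>2 = 2 * (2 * N)"
      by (simp add: N_def power2_eq_square)
    finally show ?thesis by simp
  qed
  have p_mult: "c * (\<i> + 2 * p n) = \<i> * of_int n" for n
    using c by (simp add: p_def field_simps)
  have p_uminus: "p (- n) = - \<i> - p n" for n
    by (simp add: p_def)
  have p_inj: "inj p"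
    using c by (auto simp: inj_on_def p_def)
  have D_p: "of_real pi * c * (\<i> + 2 * p n) = \<i> * of_real pi * of_int n" for n
    using p_mult[of n] by (metis mult.assoc mult.commute)
  have D_0_iff: "D x = 0 \<longleftrightarrow> (\<exists>n. x = p n)" for x
  proof -
    have "of_real pi * c * (\<i> + 2 * x) = \<i> * of_real pi * of_int n \<longleftrightarrow> x = p n" for n
      unfolding D_p[symmetric] using c by auto
    then show ?thesis
      unfolding D_def sinh_eq_0_iff_complex by blast
  qed
  have D_deriv: "(D has_field_derivative 2 * of_real pi * c * (-1) ^ nat \<bar>n\<bar>) (at (p n))" for n
  proof -
    have "(D has_field_derivative cosh (of_real pi * c * (\<i> + 2 * p n)) * (of_real pi * c * 2)) (at (p n))"
      unfolding D_def by (auto intro!: derivative_eq_intros)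
    then show ?thesis
      unfolding D_p cosh_i_pi_int by (simp add: mult_ac)
  qed
  have D_analytic: "D analytic_on A" for A
    unfolding D_def sinh_field_def by (intro analytic_intros) auto
  have p_le_iff: "\<bar>of_int n\<bar> * \<bar>q\<bar> \<le> N \<longleftrightarrow> n \<in> {-int M..int M}" for n :: int
  proof -
    have "\<bar>of_int n\<bar> * \<bar>q\<bar> \<le> N \<longleftrightarrow> of_int \<bar>n\<bar> \<le> N / \<bar>q\<bar>"
      using \<open>q \<noteq> 0\<close> by (simp add: pos_le_divide_eq)
    also have "\<dots> \<longleftrightarrow> \<bar>n\<bar> \<le> \<lfloor>N / \<bar>q\<bar>\<rfloor>"
      by (rule le_floor_iff[symmetric])
    also have "\<lfloor>N / \<bar>q\<bar>\<rfloor> = int M"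
      using \<open>N > 0\<close> by (simp add: M_def N_def)
    finally show ?thesis by auto
  qed
  have g_p: "g (p n) = F (of_real a * (c\<^sup>2 - (of_int n)\<^sup>2) / (4 * c\<^sup>2))" for n
    unfolding g_def
  proof (rule arg_cong[of _ _ F])
    have "p n * (p n + \<i>) = (c\<^sup>2 - (of_int n)\<^sup>2) / (4 * c\<^sup>2)"
      using c by (simp add: p_def field_simps power2_eq_square)
    then show "of_real a * p n * (p n + \<i>) = of_real a * (c\<^sup>2 - (of_int n)\<^sup>2) / (4 * c\<^sup>2)"
      by (simp add: mult.assoc)
  qed

  \<comment> \<open>The bound \<open>\<beta>\<close> on the distance to the centre line \<open>Im x = - 1/2\<close> exceeds \<open>1/2\<close>, so that \<open>V\<close>
    contains the closed strip, and equals the distance of \<open>p (M + 1)\<close> from that line, so that \<open>V\<close>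
    contains no \<open>p n\<close> outside the strip.\<close>
  define \<beta> where "\<beta> = (real M + 1) * \<bar>q\<bar> / (2 * N)"
  define V where "V = (\<lambda>x. of_real a * x * (x + \<i>)) -` U \<inter> {x. \<bar>Im x + 1/2\<bar> < \<beta>}"
  have "open V"
  proof -
    have "open ((\<lambda>x. of_real a * x * (x + \<i>)) -` U)"
      using \<open>open U\<close> by (intro open_vimage continuous_intros) auto
    moreover have "open {x. \<bar>Im x + 1/2\<bar> < \<beta>}"
      by (intro open_Collect_less continuous_intros)
    ultimately show ?thesis
      unfolding V_def by (rule open_Int)
  qed
  have "strip \<subseteq> V"
  proof -
    have "1/2 < \<beta>"
      using p_le_iff[of "int M + 1"] \<open>N > 0\<close> by (simp add: \<beta>_def field_simps)
    then show ?thesis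
      using assms(5) by (auto simp: V_def strip_def)
  qed
  have g_analytic: "g analytic_on V"
  proof -
    have "(F \<circ> (\<lambda>x. of_real a * x * (x + \<i>))) analytic_on V"
      using \<open>F analytic_on U\<close>
      by (intro analytic_on_compose_gen[of _ _ _ U]) (auto intro!: analytic_intros simp: V_def)
    then show ?thesis
      by (simp add: o_def g_def[abs_def])
  qed
  have g_at: "g analytic_on {x}" if "x \<in> V" for x
    using g_analytic that by (auto intro: analytic_on_subset)
  have real_V: "of_real x \<in> V" for x
    using \<open>strip \<subseteq> V\<close> by (auto simp: strip_def)
  have h_analytic: "h analytic_on {x}" if "x \<in> V" "D x \<noteq> 0" for x
    unfolding h_eq using that by (auto intro!: analytic_intros g_at D_analytic)
  have D_deriv_nz: "2 * of_real pi * c * (-1) ^ nat \<bar>n\<bar> \<noteq> 0" for n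
    using c by simp

  have poles: "\<not> is_pole h (of_real x)" if "N / q \<notin> \<int>" for x :: real
  proof -
    have "D (of_real x) \<noteq> 0"
    proof
      assume "D (of_real x) = 0"
      then obtain n where "of_real x = p n"
        by (auto simp: D_0_iff)
      then have "Im (p n) = 0"
        by (metis Im_complex_of_real)
      then have "N / q = of_int n"
        using \<open>q \<noteq> 0\<close> \<open>N > 0\<close> by (simp add: Im_p field_simps)
      with that show False by simp
    qed
    then show ?thesis
      using h_analytic[OF real_V] analytic_at not_is_pole_holomorphic by blast
  qed

  moreover have "has_symmetric_integral (\<lambda>x. remove_sings h (of_real x))
             (- (\<i> / 2) * (F (of_real a / 4) / c)
              - \<i> / c * (\<Sum>n = 1..M. (-1) ^ n *
                   F (of_real a * (c\<^sup>2 - (of_nat n)\<^sup>2) / (4 * c\<^sup>2))))"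
    if no_pole: "\<And>x::real. \<not> is_pole h (of_real x)"
  proof -
    define f where "f = remove_sings h"
    \<comment> \<open>The indices of the zeros in the open strip; \<open>{-int M..int M}\<close> is the closed counterpart.\<close>
    define K where "K = {n::int. \<bar>of_int n\<bar> * \<bar>q\<bar> < N}"
    have K_sub: "K \<subseteq> {-int M..int M}"
      using p_le_iff by (force simp: K_def)
    then have "finite K"
      using finite_subset by blast
    have p_strip: "p n \<in> strip \<longleftrightarrow> n \<in> {-int M..int M}" for n
    proof -
      have "p n \<in> strip \<longleftrightarrow> \<bar>of_int n * q / (2 * N)\<bar> \<le> 1/2"
        unfolding strip_def Im_p mem_Collect_eq abs_le_iff by linarith
      also have "\<bar>of_int n * q / (2 * N)\<bar> \<le> 1/2 \<longleftrightarrow> \<bar>of_int n\<bar> * \<bar>q\<bar> \<le> N"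
        using \<open>N > 0\<close> by (simp add: abs_mult field_simps)
      finally show ?thesis
        unfolding p_le_iff .
    qed
    have p_V: "p n \<in> V" if "n \<in> {-int M..int M}" for n
      using that \<open>strip \<subseteq> V\<close> p_strip by blast
    have g_boundary: "g (p n) = 0" if "\<bar>of_int n\<bar> * \<bar>q\<bar> = N" for n
    proof -
      have real_zero: "g (p m) = 0" if "m * q = N" for m
      proof (rule ccontr)
        assume "g (p m) \<noteq> 0"
        have "Im (p m) = 0"
          using that \<open>N > 0\<close> by (simp add: Im_p)
        then have eq: "p m = of_real (Re (p m))"
          by (simp add: complex_eq_iff)
        have "p m \<in> V" "D (p m) = 0"
          using eq real_V by (metis, auto simp: D_0_iff)
        then have "is_pole h (p m)"
          unfolding h_eq using \<open>g (p m) \<noteq> 0\<close>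
          by (intro is_pole_simple_zero_quotient[OF g_at D_analytic _ D_deriv D_deriv_nz])
        with no_pole eq show False by metis
      qed
      have "of_int n * q = N \<or> of_int (- n) * q = N"
        using that by (auto simp: abs_if split: if_splits)
      then show ?thesis
        using real_zero[of n] real_zero[of "- n"] g_sym[of "p n"] by (auto simp: p_uminus)
    qed
    have f_analytic: "f analytic_on {x}" if x: "x \<in> V - p ` K" for x
    proof (cases "D x = 0")
      case False
      with x h_analytic show ?thesis
        by (auto simp: f_def intro!: remove_sings_analytic_on)
    next
      case True
      then obtain n where n: "x = p n" by (auto simp: D_0_iff)
      have "\<bar>of_int n\<bar> * \<bar>q\<bar> / (2 * N) < \<beta>"
        using x \<open>N > 0\<close> by (auto simp: n V_def Im_p abs_mult)
      then have "\<bar>real_of_int n\<bar> < real M + 1"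
        using \<open>N > 0\<close> \<open>q \<noteq> 0\<close> by (simp add: \<beta>_def divide_less_cancel)
      then have "\<bar>of_int n\<bar> * \<bar>q\<bar> \<le> N"
        unfolding p_le_iff by auto
      moreover have "\<not> \<bar>of_int n\<bar> * \<bar>q\<bar> < N"
        using x n by (auto simp: K_def)
      ultimately have g0: "g (p n) = 0"
        by (intro g_boundary) auto
      have *: "g analytic_on {p n}" "D analytic_on {p n}" "D (p n) = 0"
        using x n True by (auto intro: g_at D_analytic)
      show ?thesis
        unfolding f_def h_eq n
        by (rule remove_sings_analytic_at[OF
              isolated_singularity_at_simple_zero_quotient[OF * D_deriv D_deriv_nz]
              tendsto_simple_zero_quotient[OF * D_deriv D_deriv_nz g0]])
    qed
    have residue_f: "residue f (p n) = (-1) ^ nat \<bar>n\<bar> * g (p n) / (2 * of_real pi * c)"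
      if "n \<in> K" for n
    proof -
      have "p n \<in> V"
        using that K_sub p_V by blast
      then have *: "g analytic_on {p n}" "D analytic_on {p n}" "D (p n) = 0"
        by (auto intro: g_at D_analytic simp: D_0_iff)
      have "residue f (p n) = residue h (p n)"
        unfolding f_def h_eq
        by (intro residue_cong eventually_remove_sings_eq_at refl
            isolated_singularity_at_simple_zero_quotient[OF * D_deriv D_deriv_nz])
      also have "\<dots> = g (p n) / (2 * of_real pi * c * (-1) ^ nat \<bar>n\<bar>)"
        unfolding h_eq by (rule residue_simple_zero_quotient[OF * D_deriv D_deriv_nz])
      also have "\<dots> = (-1) ^ nat \<bar>n\<bar> * g (p n) / (2 * of_real pi * c)"
        by (cases "even (nat \<bar>n\<bar>)") simp_all
      finally show ?thesis .
    qed
    define t where "t n = (-1) ^ nat \<bar>n\<bar> * g (p n)" for n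
    have "has_symmetric_integral (\<lambda>x. f (of_real x)) (- (pi * \<i>) * (\<Sum>z\<in>p ` K. residue f z))"
    proof (rule odd_strip_integral[OF \<open>open V\<close> \<open>strip \<subseteq> V\<close>])
      show "finite (p ` K)"
        using \<open>finite K\<close> by simp
      show "p ` K \<subseteq> {z. -1 < Im z \<and> Im z < 0}"
      proof -
        have bound: "\<bar>of_int n * q / (2 * N)\<bar> < 1/2" if "n \<in> K" for n
          using that \<open>N > 0\<close> by (simp add: K_def abs_mult field_simps)
        have "- 1 < Im (p n) \<and> Im (p n) < 0" if "n \<in> K" for n
          unfolding Im_p using bound[OF that] by linarith
        then show ?thesis
          by blast
      qed
      show "f holomorphic_on V - p ` K"
        using f_analytic by (intro analytic_imp_holomorphic) (subst analytic_on_analytic_at, blast)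
      show "f (- \<i> - z) = - f z" for z
      proof -
        have "filtermap (\<lambda>w. - \<i> - w) (at z) = filtermap (\<lambda>w. w - \<i>) (filtermap uminus (at z))"
          unfolding filtermap_filtermap by (rule arg_cong2[of _ _ _ _ filtermap]) auto
        also have "\<dots> = at (- \<i> - z)"
          unfolding filtermap_at_minus filtermap_at_shift by (rule arg_cong[of _ _ at]) simp
        finally have "remove_sings (h \<circ> (\<lambda>w. - \<i> - w)) z = f (- \<i> - z)"
          unfolding f_def by (rule remove_sings_compose)
        also have "h \<circ> (\<lambda>w. - \<i> - w) = (\<lambda>w. - h w)"
          by (simp add: fun_eq_iff h_eq g_sym D_odd)
        also have "remove_sings (\<lambda>w. - h w) z = - f z"
          unfolding f_def by (rule remove_sings_minus)
        finally show ?thesis by simp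
      qed
      show "(f \<longlongrightarrow> 0) strip_ends"
      proof -
        have "(h \<longlongrightarrow> 0) strip_ends"
          using assms(8) by (simp add: h_eq g_def D_def add.commute)
        moreover have "eventually (\<lambda>z. h z = f z) strip_ends"
        proof -
          have "bounded ((\<lambda>n. Re (p n)) ` {-int M..int M})"
            by (intro finite_imp_bounded) auto
          then obtain B where B: "\<And>n. n \<in> {-int M..int M} \<Longrightarrow> \<bar>Re (p n)\<bar> \<le> B"
            unfolding bounded_iff ball_simps real_norm_def by blast
          have "h z = f z" if z: "z \<in> strip" "B + 1 \<le> \<bar>Re z\<bar>" for z
          proof -
            have "D z \<noteq> 0"
              using z B p_strip by (force simp: D_0_iff)
            then show ?thesis
              using h_analytic z(1) \<open>strip \<subseteq> V\<close> by (auto simp: f_def)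
          qed
          then show ?thesis
            unfolding eventually_strip_ends by blast
        qed
        ultimately show ?thesis
          by (rule Lim_transform_eventually)
      qed
    qed
    also have "(\<Sum>z\<in>p ` K. residue f z) = (\<Sum>n\<in>K. t n) / (2 * of_real pi * c)"
      using inj_on_subset[OF p_inj]
      by (simp add: sum.reindex residue_f t_def sum_divide_distrib)
    also have "(\<Sum>n\<in>K. t n) = (\<Sum>n\<in>{-int M..int M}. t n)"
    proof (rule sum.mono_neutral_left)
      show "\<forall>n\<in>{-int M..int M} - K. t n = 0"
        using g_boundary p_le_iff unfolding K_def t_def by (metis (mono_tags, lifting) DiffE
            mem_Collect_eq mult_zero_right order_less_le)
    qed (use K_sub in auto)
    also have "\<dots> = t 0 + 2 * (\<Sum>n=1..M. t (int n))"
      by (rule sum_symmetric_int) (simp add: t_def p_uminus g_sym)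
    also have "- (pi * \<i>) * ((t 0 + 2 * (\<Sum>n=1..M. t (int n))) / (2 * of_real pi * c))
        = - (\<i> / 2) * (t 0 / c) - \<i> / c * (\<Sum>n=1..M. t (int n))"
      using c by (simp add: field_simps)
    also have "t 0 = F (of_real a / 4)"
      using c by (simp add: t_def g_p)
    finally show ?thesis
      by (simp add: t_def g_p f_def)
  qed
  ultimately show ?thesis
    by (simp add: h_def N_def)
qed

end
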